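(* Let $L$ be a compact metric space. Let $((X_n,\alpha_n))_{n\in\mathbb{N}}$ be a sequence of $L$-labeled compact metric spaces such that (1) $\{X_n : n\in\mathbb{N}\}$ is uniformly totally bounded, and (2) $d_{X_n}(\alpha_n(\ell),\alpha_n(\ell'))\to 0$ as $n\to\infty$ and $d_L(\ell,\ell')\to 0$; that is, for every $\varepsilon>0$ there exist $N\in\mathbb{N}$ and $\delta>0$ such that $d_{X_n}(\alpha_n(\ell),\alpha_n(\ell'))\le\varepsilon$ whenever $n\ge N$ and $d_L(\ell,\ell')\le\delta$. Then $((X_n,\alpha_n))_{n\in\mathbb{N}}$ has a subsequence which converges, with respect to $d_{GH}^L$, to an $L$-labeled metric space $(X,\alpha)$ where $\alpha\colon L\to X$ is continuous.
   Context: All metric spaces are assumed to be compact. Given a set $L$, an $L$-labeled metric space is a pair $(X,\alpha)$ where $X$ is a (compact) metric space and $\alpha\colon L\to X$ is an arbitrary (not necessarily continuous) map (a labeling). For $L$-labeled metric spaces $(X,\alpha)$, $(Y,\beta)$ and $t\ge 0$, a pseudometric $d\colon (X\sqcup Y)^2\to[0,\infty)$ on the disjoint union is called $(t,L)$-admissible if (1) $d|_{X\times X}=d_X$ and $d|_{Y\times Y}=d_Y$; (2) $d_H(X,Y)\le t$, where $d_H$ is the Hausdorff distance with respect to $d$; (3) $\sup_{\ell\in L}d(\alpha(\ell),\beta(\ell))\le t$ (with $\sup\varnothing=0$). The labeled Gromov-Hausdorff (LGH) distance is $$d_{GH}^L(X,\alpha;Y,\beta):=\inf\{t : \text{there exists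 a } (t,L)\text{-admissible pseudometric on } X\sqcup Y\}.$$ A collection of metric spaces is uniformly totally bounded if (1) there is a constant $d>0$ such that $\operatorname{diam}X\le d$ for all $X$ in the collection, and (2) for any $\varepsilon>0$ there is $N_\varepsilon\in\mathbb{N}$ such that any $X$ in the collection has an $\varepsilon$-net consisting of at most $N_\varepsilon$ points (an $\varepsilon$-net being a subset $S\subseteq X$ such that every point of $X$ is at distance less than $\varepsilon$ from some point of $S$). *)

theory Defs
  imports "HOL-Analysis.Analysis"
begin

text \<open>
  Metric spaces are elements of the library type \<open>'a metric\<close>, so the underlying set may be any subset
  of \<open>'a\<close>, possibly empty. Members of a sequence of metric spaces share the type \<open>'a\<close>, but
  their carriers are unrelated subsets of it. Every compact metric space is isometric to one with
  points in \<open>nat \<Rightarrow> real\<close>, via \<open>x \<mapsto> (\<lambda>i. d x (s i))\<close> for a dense sequence \<open>s\<close>; this is the type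
  to use for a limit space that has to be produced.
\<close>

definition compact_metric :: "'a metric \<Rightarrow> bool" where
  "compact_metric X \<longleftrightarrow> compact_space (mtopology_of X)"

definition labeled_metric_space :: "'l set \<Rightarrow> 'a metric \<Rightarrow> ('l \<Rightarrow> 'a) \<Rightarrow> bool" where
  "labeled_metric_space L X \<alpha> \<longleftrightarrow> compact_metric X \<and> \<alpha> \<in> L \<rightarrow> mspace X"

definition pseudometric_on :: "'a set \<Rightarrow> ('a \<Rightarrow> 'a \<Rightarrow> real) \<Rightarrow> bool" where
  "pseudometric_on S d \<longleftrightarrow>
     (\<forall>x\<in>S. \<forall>y\<in>S. 0 \<le> d x y) \<and>
     (\<forall>x\<in>S. d x x = 0) \<and>
     (\<forall>x\<in>S. \<forall>y\<in>S. d x y = d y x) \<and>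
     (\<forall>x\<in>S. \<forall>y\<in>S. \<forall>z\<in>S. d x z \<le> d x y + d y z)"

text \<open>
  In \<open>ennreal\<close> the supremum of the empty set is \<open>0\<close> and its infimum is \<open>\<infinity>\<close>. Hence the distance
  between two empty sets is \<open>0\<close>, and that between an empty and a nonempty set is \<open>\<infinity>\<close>.
\<close>

definition hausdorff_distance :: "('a \<Rightarrow> 'a \<Rightarrow> real) \<Rightarrow> 'a set \<Rightarrow> 'a set \<Rightarrow> ennreal" where
  "hausdorff_distance d A B =
     max (SUP a\<in>A. INF b\<in>B. ennreal (d a b)) (SUP b\<in>B. INF a\<in>A. ennreal (d a b))"

definition admissible ::
    "real \<Rightarrow> 'l set \<Rightarrow> 'a metric \<Rightarrow> ('l \<Rightarrow> 'a) \<Rightarrow> 'b metric \<Rightarrow> ('l \<Rightarrow> 'b) \<Rightarrow>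
     ('a + 'b \<Rightarrow> 'a + 'b \<Rightarrow> real) \<Rightarrow> bool" where
  "admissible t L X \<alpha> Y \<beta> d \<longleftrightarrow>
     pseudometric_on (mspace X <+> mspace Y) d \<and>
     (\<forall>x\<in>mspace X. \<forall>x'\<in>mspace X. d (Inl x) (Inl x') = mdist X x x') \<and>
     (\<forall>y\<in>mspace Y. \<forall>y'\<in>mspace Y. d (Inr y) (Inr y') = mdist Y y y') \<and>
     hausdorff_distance d (Inl ` mspace X) (Inr ` mspace Y) \<le> ennreal t \<and>
     (SUP l\<in>L. ennreal (d (Inl (\<alpha> l)) (Inr (\<beta> l)))) \<le> ennreal t"

definition LGH_distance ::
    "'l set \<Rightarrow> 'a metric \<Rightarrow> ('l \<Rightarrow> 'a) \<Rightarrow> 'b metric \<Rightarrow> ('l \<Rightarrow> 'b) \<Rightarrow> ennreal" where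
  "LGH_distance L X \<alpha> Y \<beta> = Inf {ennreal t | t. 0 \<le> t \<and> (\<exists>d. admissible t L X \<alpha> Y \<beta> d)}"

definition metric_diameter :: "'a metric \<Rightarrow> ennreal" where
  "metric_diameter X = (SUP x\<in>mspace X. SUP y\<in>mspace X. ennreal (mdist X x y))"

definition is_net :: "real \<Rightarrow> 'a metric \<Rightarrow> 'a set \<Rightarrow> bool" where
  "is_net \<epsilon> X S \<longleftrightarrow> S \<subseteq> mspace X \<and> (\<forall>x\<in>mspace X. \<exists>s\<in>S. mdist X x s < \<epsilon>)"

definition uniformly_totally_bounded :: "'a metric set \<Rightarrow> bool" where
  "uniformly_totally_bounded \<X> \<longleftrightarrow>
     (\<exists>d>0. \<forall>X\<in>\<X>. metric_diameter X \<le> ennreal d) \<and>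
     (\<forall>\<epsilon>>0. \<exists>N::nat. \<forall>X\<in>\<X>. \<exists>S. is_net \<epsilon> X S \<and> finite S \<and> card S \<le> N)"

end

theory Submission
  imports Defs "HOL-Complex_Analysis.Great_Picard"
begin

text \<open>
  Uniform total boundedness gives sequences \<open>p n\<close> of points of \<open>X n\<close> such that the \<^emph>\<open>same\<close> finite sets of
  indices yield \<open>\<epsilon>\<close>-nets in all \<open>X n\<close>. Along a diagonal subsequence the distances \<open>d (p n i) (p n j)\<close>
  converge to a pseudometric \<open>D\<close> on \<open>nat\<close>, whose completion \<open>Y\<close> is compact and is the limit space.
  By asymptotic equicontinuity and separability of \<open>L\<close>, also \<open>d (\<alpha> n l) (p n i)\<close> converges
  for every label \<open>l\<close>; the limits, as functions of \<open>i\<close>, are the distances from the limit label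
  \<open>\<beta> l\<close> to the dense points of \<open>Y\<close>, and compactness of \<open>L\<close> makes the convergence uniform in \<open>l\<close>.
  Pairing points of \<open>X n\<close> and \<open>Y\<close> that lie near the same net point is then a correspondence of
  small distortion that contains all pairs of labels, and it bounds the distance.
\<close>

section \<open>Bounding the distance by a correspondence\<close>

text \<open>This is one half of the description of Gromov-Hausdorff distance by correspondences.
  Labels need no separate treatment, since \<open>R\<close> contains the label pairs and all pairs
  of \<open>R\<close> are glued at distance at most \<open>\<epsilon>\<close>. \<open>R\<close> is
  nonempty because the gluing uses a real infimum over \<open>R\<close>.\<close>

lemma LGH_distance_le_correspondence:
  fixes X :: "'a metric" and Y :: "'b metric"
  assumes "R \<noteq> {}" and R: "R \<subseteq> mspace X \<times> mspace Y" and "0 \<le> \<epsilon>"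
    and left: "\<And>x. x \<in> mspace X \<Longrightarrow> \<exists>y. (x, y) \<in> R"
    and right: "\<And>y. y \<in> mspace Y \<Longrightarrow> \<exists>x. (x, y) \<in> R"
    and distortion: "\<And>x y x' y'. \<lbrakk>(x, y) \<in> R; (x', y') \<in> R\<rbrakk> \<Longrightarrow> \<bar>mdist X x x' - mdist Y y y'\<bar> \<le> 2 * \<epsilon>"
    and labels: "\<And>l. l \<in> L \<Longrightarrow> (\<alpha> l, \<beta> l) \<in> R"
  shows "LGH_distance L X \<alpha> Y \<beta> \<le> ennreal \<epsilon>"
proof -
  \<comment> \<open>Glue the spaces by putting corresponding points at distance \<open>\<epsilon>\<close>; the triangle inequality needs
    \<open>\<epsilon>\<close> to be at least half the distortion.\<close>
  define \<delta> where "\<delta> x y = (INF (a, b)\<in>R. mdist X x a + \<epsilon> + mdist Y b y)" for x y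
  \<comment> \<open>All later work with the infimum goes through two rules: to bound it above, pick
    one pair; to bound it below, check every pair.\<close>
  have \<delta>_le: "\<delta> x y \<le> mdist X x a + \<epsilon> + mdist Y b y" if "(a, b) \<in> R" for x y a b
    unfolding \<delta>_def
    by (rule cINF_lower2[OF _ that])
      (use \<open>0 \<le> \<epsilon>\<close> in \<open>auto intro!: bdd_belowI2[where m = 0] simp: case_prod_beta\<close>)
  have \<delta>_ge: "c \<le> \<delta> x y" if "\<And>a b. (a, b) \<in> R \<Longrightarrow> c \<le> mdist X x a + \<epsilon> + mdist Y b y" for c x y
    unfolding \<delta>_def using \<open>R \<noteq> {}\<close> that by (intro cINF_greatest) auto
  have \<delta>_R: "\<delta> x y \<le> \<epsilon>" if "(x, y) \<in> R" for x y
  proof -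
    have "mdist X x x = 0" "mdist Y y y = 0" using that R by auto
    then show ?thesis using \<delta>_le[OF that, of x y] by simp
  qed
  have \<delta>_nonneg: "0 \<le> \<delta> x y" for x y
    using \<open>0 \<le> \<epsilon>\<close> by (intro \<delta>_ge) auto
  \<comment> \<open>The letters in the names of the \<open>tri\<close> facts give the spaces of the
    start, the intermediate and the end point. With the triangle inequalities inside
    \<open>X\<close> and inside \<open>Y\<close> they make up the eight cases needed for
    \<open>d\<close>.\<close>
  have tri_XXY: "\<delta> x y \<le> mdist X x x' + \<delta> x' y" if "x \<in> mspace X" "x' \<in> mspace X" for x x' y
  proof -
    have "\<delta> x y - mdist X x x' \<le> \<delta> x' y"
    proof (rule \<delta>_ge)
      fix a b assume ab: "(a, b) \<in> R"
      then show "\<delta> x y - mdist X x x' \<le> mdist X x' a + \<epsilon> + mdist Y b y"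
        using \<delta>_le[OF ab, of x y] mdist_triangle[of x X x' a] that R by auto
    qed
    then show ?thesis by simp
  qed
  have tri_XYY: "\<delta> x y \<le> \<delta> x y' + mdist Y y' y" if "y \<in> mspace Y" "y' \<in> mspace Y" for x y y'
  proof -
    have "\<delta> x y - mdist Y y' y \<le> \<delta> x y'"
    proof (rule \<delta>_ge)
      fix a b assume ab: "(a, b) \<in> R"
      then show "\<delta> x y - mdist Y y' y \<le> mdist X x a + \<epsilon> + mdist Y b y'"
        using \<delta>_le[OF ab, of x y] mdist_triangle[of b Y y' y] that R by auto
    qed
    then show ?thesis by simp
  qed
  have tri_XYX: "mdist X x x' \<le> \<delta> x y + \<delta> x' y"
    if x: "x \<in> mspace X" and x': "x' \<in> mspace X" and y: "y \<in> mspace Y" for x x' y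
  proof -
    have "mdist X x x' - \<delta> x y \<le> \<delta> x' y"
    proof (rule \<delta>_ge)
      fix a' b' assume ab': "(a', b') \<in> R"
      \<comment> \<open>After both infima are reduced to single pairs, go from \<open>x\<close> to
        \<open>x'\<close> via \<open>a\<close> and \<open>a'\<close>. The distance from
        \<open>a\<close> to \<open>a'\<close> is at most \<open>2 * \<epsilon>\<close> more than
        that from \<open>b\<close> to \<open>b'\<close>, which is bounded via \<open>y\<close>; the
        two gluing terms \<open>\<epsilon>\<close> pay for the excess.\<close>
      have "mdist X x x' - (mdist X x' a' + \<epsilon> + mdist Y b' y) \<le> \<delta> x y"
      proof (rule \<delta>_ge)
        fix a b assume ab: "(a, b) \<in> R"
        have "a \<in> mspace X" "a' \<in> mspace X" "b \<in> mspace Y" "b' \<in> mspace Y"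
          using ab ab' R by auto
        then show "mdist X x x' - (mdist X x' a' + \<epsilon> + mdist Y b' y) \<le> mdist X x a + \<epsilon> + mdist Y b y"
          using distortion[OF ab ab'] mdist_triangle[of x X a x'] mdist_triangle[of a X a' x']
            mdist_triangle[of b Y y b'] x x' y
          by (simp add: mdist_commute[of X a' x'] mdist_commute[of Y y b'])
      qed
      then show "mdist X x x' - \<delta> x y \<le> mdist X x' a' + \<epsilon> + mdist Y b' y" by simp
    qed
    then show ?thesis by simp
  qed
  have tri_YXY: "mdist Y y y' \<le> \<delta> x y + \<delta> x y'"
    if x: "x \<in> mspace X" and y: "y \<in> mspace Y" and y': "y' \<in> mspace Y" for x y y'
  proof -
    have "mdist Y y y' - \<delta> x y \<le> \<delta> x y'"
    proof (rule \<delta>_ge)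
      fix a' b' assume ab': "(a', b') \<in> R"
      have "mdist Y y y' - (mdist X x a' + \<epsilon> + mdist Y b' y') \<le> \<delta> x y"
      proof (rule \<delta>_ge)
        fix a b assume ab: "(a, b) \<in> R"
        have "a \<in> mspace X" "a' \<in> mspace X" "b \<in> mspace Y" "b' \<in> mspace Y"
          using ab ab' R by auto
        then show "mdist Y y y' - (mdist X x a' + \<epsilon> + mdist Y b' y') \<le> mdist X x a + \<epsilon> + mdist Y b y"
          using distortion[OF ab ab'] mdist_triangle[of y Y b y'] mdist_triangle[of b Y b' y']
            mdist_triangle[of a X x a'] x y y'
          by (simp add: mdist_commute[of X a x] mdist_commute[of Y y b])
      qed
      then show "mdist Y y y' - \<delta> x y \<le> mdist X x a' + \<epsilon> + mdist Y b' y'" by simp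
    qed
    then show ?thesis by simp
  qed
  have tri_YXX: "\<delta> x y \<le> \<delta> x' y + mdist X x' x" if "x \<in> mspace X" "x' \<in> mspace X" for x x' y
    using tri_XXY[OF that, of y] by (simp add: mdist_commute)
  have tri_YYX: "\<delta> x y \<le> mdist Y y y' + \<delta> x y'" if "y \<in> mspace Y" "y' \<in> mspace Y" for x y y'
    using tri_XYY[OF that, of x] by (simp add: mdist_commute)
  define d where "d u v = (case u of
      Inl x \<Rightarrow> (case v of Inl x' \<Rightarrow> mdist X x x' | Inr y \<Rightarrow> \<delta> x y)
    | Inr y \<Rightarrow> (case v of Inl x \<Rightarrow> \<delta> x y | Inr y' \<Rightarrow> mdist Y y y'))" for u v
  have d_simps [simp]: "d (Inl x) (Inl x') = mdist X x x'" "d (Inl x) (Inr y) = \<delta> x y"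
    "d (Inr y) (Inl x) = \<delta> x y" "d (Inr y) (Inr y') = mdist Y y y'" for x x' y y'
    by (simp_all add: d_def)
  have "pseudometric_on (mspace X <+> mspace Y) d"
    unfolding pseudometric_on_def
  proof (intro conjI ballI)
    fix u v w assume u: "u \<in> mspace X <+> mspace Y" and v: "v \<in> mspace X <+> mspace Y"
      and w: "w \<in> mspace X <+> mspace Y"
    show "d u w \<le> d u v + d v w"
      using u v w
      by (elim PlusE; hypsubst; unfold d_simps)
        (intro mdist_triangle tri_XXY tri_XYY tri_XYX tri_YXY tri_YXX tri_YYX; assumption)+
  qed (auto simp: \<delta>_nonneg mdist_commute)
  moreover have "hausdorff_distance d (Inl ` mspace X) (Inr ` mspace Y) \<le> ennreal \<epsilon>"
    unfolding hausdorff_distance_def image_image d_simps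
  proof (intro max.boundedI SUP_least)
    fix x assume "x \<in> mspace X"
    then obtain y where "(x, y) \<in> R" using left by blast
    with R show "(INF y\<in>mspace Y. ennreal (\<delta> x y)) \<le> ennreal \<epsilon>"
      by (intro INF_lower2[of y]) (auto intro: ennreal_leI \<delta>_R)
  next
    fix y assume "y \<in> mspace Y"
    then obtain x where "(x, y) \<in> R" using right by blast
    with R show "(INF x\<in>mspace X. ennreal (\<delta> x y)) \<le> ennreal \<epsilon>"
      by (intro INF_lower2[of x]) (auto intro: ennreal_leI \<delta>_R)
  qed
  moreover have "(SUP l\<in>L. ennreal (d (Inl (\<alpha> l)) (Inr (\<beta> l)))) \<le> ennreal \<epsilon>"
    by (auto intro!: SUP_least ennreal_leI \<delta>_R labels)
  ultimately have "admissible \<epsilon> L X \<alpha> Y \<beta> d"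
    by (simp add: admissible_def)
  then show ?thesis
    unfolding LGH_distance_def using \<open>0 \<le> \<epsilon>\<close> by (intro Inf_lower) auto
qed

section \<open>Limits of net conditions, and the limit space\<close>

lemma abs_mdist_diff_le:
  assumes "x \<in> mspace X" "y \<in> mspace X" "z \<in> mspace X"
  shows "\<bar>mdist X x z - mdist X y z\<bar> \<le> mdist X x y"
  using mdist_triangle[of x X y z] mdist_triangle[of y X x z] assms by (simp add: mdist_commute)

text \<open>The good index may change with \<open>n\<close>, but if every limit exceeded
  \<open>\<epsilon>\<close>, finiteness of \<open>F\<close> would give a single \<open>n\<close> at
  which all \<open>g n i\<close> exceed it. Thus nets indexed by a finite set independent of
  \<open>n\<close> survive the limit.\<close>

lemma finite_cover_limit:
  fixes g :: "nat \<Rightarrow> 'i \<Rightarrow> real"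
  assumes "finite F" and lim: "\<And>i. i \<in> F \<Longrightarrow> (\<lambda>n. g n i) \<longlonglongrightarrow> G i"
    and small: "\<And>n. \<exists>i\<in>F. g n i \<le> \<epsilon>"
  shows "\<exists>i\<in>F. G i \<le> \<epsilon>"
proof (rule ccontr)
  assume "\<not> (\<exists>i\<in>F. G i \<le> \<epsilon>)"
  then have "\<forall>\<^sub>F n in sequentially. \<epsilon> < g n i" if "i \<in> F" for i
    using order_tendstoD(1)[OF lim[OF that]] that by auto
  then have "\<forall>\<^sub>F n in sequentially. \<forall>i\<in>F. \<epsilon> < g n i"
    using \<open>finite F\<close> by (simp add: eventually_ball_finite)
  then obtain n where "\<forall>i\<in>F. \<epsilon> < g n i"
    using eventually_happens by fastforce
  then show False using small[of n] by force
qed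

text \<open>
  The completion of the pseudometric space \<open>(nat, D)\<close>, each point being represented by its
  distances to the points of \<open>nat\<close>, so that the rows of \<open>D\<close> form a dense set.
\<close>

lemma compact_limit_space:
  fixes D :: "nat \<Rightarrow> nat \<Rightarrow> real"
  assumes D: "pseudometric_on UNIV D"
    and bounded: "\<And>i j. D i j \<le> B"
    and nets: "\<And>\<epsilon>. \<epsilon> > 0 \<Longrightarrow> \<exists>F. finite F \<and> (\<forall>i. \<exists>j\<in>F. D i j \<le> \<epsilon>)"
  obtains Y where "compact_metric Y"
    and "mspace Y = {f. \<forall>\<epsilon>>0. \<exists>i. \<forall>j. \<bar>f j - D i j\<bar> \<le> \<epsilon>}"
    and "\<forall>f\<in>mspace Y. \<forall>i. mdist Y f (D i) = f i"
    and "\<forall>f\<in>mspace Y. \<forall>g\<in>mspace Y. \<forall>\<epsilon>. (\<forall>j. \<bar>f j - g j\<bar> \<le> \<epsilon>) \<longrightarrow> mdist Y f g \<le> \<epsilon>"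
proof -
  define S where "S = {f :: nat \<Rightarrow> real. \<forall>\<epsilon>>0. \<exists>i. \<forall>j. \<bar>f j - D i j\<bar> \<le> \<epsilon>}"
  \<comment> \<open>The value 0 off \<open>S\<close> is chosen because \<open>Metric_space\<close>
    demands nonnegativity and symmetry for all arguments, not only those in the carrier.\<close>
  define d where "d f g = (if f \<in> S \<and> g \<in> S then SUP j. \<bar>f j - g j\<bar> else 0)" for f g
  have D_nonneg: "0 \<le> D i j" and D_refl: "D i i = 0" and D_sym: "D i j = D j i"
    and D_tri: "D i k \<le> D i j + D j k" for i j k
    using D unfolding pseudometric_on_def by blast+
  have D_diff: "\<bar>D i k - D j k\<bar> \<le> D i j" for i j k
    using D_tri[of i k j] D_tri[of j k i] D_sym[of i j] by linarith
  have near_row: "\<exists>i. \<forall>j. \<bar>f j - D i j\<bar> \<le> \<epsilon>" if "f \<in> S" "0 < \<epsilon>" for f \<epsilon>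
    using that unfolding S_def by blast
  have bdd: "bdd_above (range (\<lambda>j. \<bar>f j - g j\<bar>))" if fg: "f \<in> S" "g \<in> S" for f g
  proof -
    have bound: "\<bar>h j\<bar> \<le> B + 1" if "h \<in> S" for h j
    proof -
      obtain i where "\<forall>j. \<bar>h j - D i j\<bar> \<le> 1" using near_row[OF \<open>h \<in> S\<close> zero_less_one] by blast
      then have "\<bar>h j - D i j\<bar> \<le> 1" by blast
      then show ?thesis using bounded[of i j] D_nonneg[of i j] by linarith
    qed
    have "\<bar>f j - g j\<bar> \<le> (B + 1) + (B + 1)" for j
      using bound[OF fg(1), of j] bound[OF fg(2), of j] by linarith
    then show ?thesis by (rule bdd_aboveI2)
  qed
  have d_upper: "\<bar>f j - g j\<bar> \<le> d f g" if "f \<in> S" "g \<in> S" for f g j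
    unfolding d_def using bdd[OF that] that by (auto intro: cSUP_upper)
  have d_least: "d f g \<le> c" if "f \<in> S" "g \<in> S" "\<And>j. \<bar>f j - g j\<bar> \<le> c" for f g c
    unfolding d_def using that by (auto intro: cSUP_least)
  have d_nonneg: "0 \<le> d f g" for f g
    using order_trans[OF abs_ge_zero d_upper[of f g undefined]] by (cases "f \<in> S \<and> g \<in> S") (auto simp: d_def)
  have row: "D i \<in> S" for i
    unfolding S_def by (force intro: exI[of _ i])
  interpret M: Metric_space S d
  proof
    show "d f g = d g f" for f g by (simp add: d_def abs_minus_commute)
    show "d f g = 0 \<longleftrightarrow> f = g" if "f \<in> S" "g \<in> S" for f g
    proof
      assume "d f g = 0"
      then show "f = g" using d_upper[OF that] by (auto simp: fun_eq_iff)
    next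
      assume "f = g"
      then show "d f g = 0" by (simp add: d_def)
    qed
    show "d f h \<le> d f g + d g h" if "f \<in> S" "g \<in> S" "h \<in> S" for f g h
    proof (rule d_least)
      fix j show "\<bar>f j - h j\<bar> \<le> d f g + d g h"
        using d_upper[OF that(1,2), of j] d_upper[OF that(2,3), of j] by linarith
    qed (use that in auto)
  qed (rule d_nonneg)
  \<comment> \<open>One third of \<open>\<epsilon>\<close> is spent on replacing \<open>f\<close> by
    a row and one third on replacing that row by one from the net; the rest makes the inequality
    strict, as the open ball requires.\<close>
  have "M.mtotally_bounded S"
    unfolding M.mtotally_bounded_def
  proof (intro allI impI)
    fix \<epsilon> :: real assume "0 < \<epsilon>"
    then obtain F where "finite F" and F: "\<And>i. \<exists>j\<in>F. D i j \<le> \<epsilon> / 3"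
      using nets[of "\<epsilon> / 3"] by auto
    have "\<exists>j\<in>F. f \<in> M.mball (D j) \<epsilon>" if "f \<in> S" for f
    proof -
      obtain i where i: "\<And>k. \<bar>f k - D i k\<bar> \<le> \<epsilon> / 3"
        using near_row[OF \<open>f \<in> S\<close>, of "\<epsilon> / 3"] \<open>0 < \<epsilon>\<close> by auto
      obtain j where "j \<in> F" and j: "D i j \<le> \<epsilon> / 3" using F by blast
      have "d (D j) f \<le> 2 * \<epsilon> / 3"
      proof (rule d_least)
        fix k show "\<bar>D j k - f k\<bar> \<le> 2 * \<epsilon> / 3"
          using i[of k] D_diff[of i k j] j by linarith
      qed (use row that in auto)
      then have "f \<in> M.mball (D j) \<epsilon>" using \<open>0 < \<epsilon>\<close> row that by auto
      then show ?thesis using \<open>j \<in> F\<close> by blast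
    qed
    then show "\<exists>K. finite K \<and> K \<subseteq> S \<and> S \<subseteq> (\<Union>x\<in>K. M.mball x \<epsilon>)"
      using \<open>finite F\<close> row by (intro exI[of _ "D ` F"]) auto
  qed
  \<comment> \<open>A Cauchy sequence for the supremum metric converges uniformly to its pointwise
    limit, and \<open>S\<close> is closed under uniform limits because its members are the uniform
    limits of rows.\<close>
  moreover have "M.mcomplete"
    unfolding M.mcomplete_def
  proof (intro allI impI)
    fix \<sigma> assume \<sigma>: "M.MCauchy \<sigma>"
    then have \<sigma>_S: "\<sigma> n \<in> S" for n by (auto simp: M.MCauchy_def)
    have cauchy: "\<exists>N. \<forall>m\<ge>N. \<forall>n\<ge>N. \<forall>j. \<bar>\<sigma> m j - \<sigma> n j\<bar> < \<epsilon>" if "0 < \<epsilon>" for \<epsilon>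
      using \<sigma> that d_upper[OF \<sigma>_S \<sigma>_S] unfolding M.MCauchy_def by (meson le_less_trans)
    have "convergent (\<lambda>n. \<sigma> n j)" for j
      unfolding Cauchy_convergent_iff[symmetric] Cauchy_def dist_real_def using cauchy by meson
    then obtain f where f: "\<And>j. (\<lambda>n. \<sigma> n j) \<longlonglongrightarrow> f j"
      unfolding convergent_def by metis
    have unif: "\<exists>N. \<forall>n\<ge>N. \<forall>j. \<bar>\<sigma> n j - f j\<bar> \<le> \<epsilon>" if \<epsilon>: "0 < \<epsilon>" for \<epsilon>
    proof -
      obtain N where N: "\<And>m n j. m \<ge> N \<Longrightarrow> n \<ge> N \<Longrightarrow> \<bar>\<sigma> m j - \<sigma> n j\<bar> < \<epsilon>"
        using cauchy[OF \<epsilon>] by blast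
      have "\<bar>\<sigma> n j - f j\<bar> \<le> \<epsilon>" if "n \<ge> N" for n j
      proof (rule tendsto_upperbound)
        show "(\<lambda>m. \<bar>\<sigma> n j - \<sigma> m j\<bar>) \<longlonglongrightarrow> \<bar>\<sigma> n j - f j\<bar>"
          by (intro tendsto_intros f)
        show "\<forall>\<^sub>F m in sequentially. \<bar>\<sigma> n j - \<sigma> m j\<bar> \<le> \<epsilon>"
          using N that by (auto simp: eventually_sequentially intro!: exI[of _ N] less_imp_le)
      qed simp
      then show ?thesis by blast
    qed
    have "f \<in> S"
      unfolding S_def
    proof (intro CollectI allI impI)
      fix \<epsilon> :: real assume "0 < \<epsilon>"
      then obtain n where n: "\<And>j. \<bar>\<sigma> n j - f j\<bar> \<le> \<epsilon> / 2" using unif[of "\<epsilon> / 2"] by auto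
      obtain i where i: "\<And>j. \<bar>\<sigma> n j - D i j\<bar> \<le> \<epsilon> / 2"
        using near_row[OF \<sigma>_S, of "\<epsilon> / 2" n] \<open>0 < \<epsilon>\<close> by auto
      have "\<bar>f j - D i j\<bar> \<le> \<epsilon>" for j using n[of j] i[of j] by linarith
      then show "\<exists>i. \<forall>j. \<bar>f j - D i j\<bar> \<le> \<epsilon>" by blast
    qed
    have "\<exists>N. \<forall>n\<ge>N. \<sigma> n \<in> S \<and> d (\<sigma> n) f < \<epsilon>" if "0 < \<epsilon>" for \<epsilon>
    proof -
      obtain N where N: "\<forall>n\<ge>N. \<forall>j. \<bar>\<sigma> n j - f j\<bar> \<le> \<epsilon> / 2" using unif[of "\<epsilon> / 2"] \<open>0 < \<epsilon>\<close> by auto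
      have "d (\<sigma> n) f < \<epsilon>" if "n \<ge> N" for n
        using d_least[OF \<sigma>_S \<open>f \<in> S\<close>, of n "\<epsilon> / 2"] N that \<open>0 < \<epsilon>\<close> by auto
      then show ?thesis using \<sigma>_S by blast
    qed
    then show "\<exists>f. limitin M.mtopology \<sigma> f sequentially"
      using \<open>f \<in> S\<close> unfolding M.limit_metric_sequentially by blast
  qed
  ultimately have "compact_space M.mtopology"
    by (simp add: M.compact_space_eq_mcomplete_mtotally_bounded)
  \<comment> \<open>If row \<open>k\<close> is uniformly close to \<open>f\<close>, then
    \<open>f j - D i j\<close> is close to \<open>D k j - D i j\<close>, which is at most
    \<open>D k i\<close> in absolute value, and this is close to \<open>f i\<close>. The supremum is
    attained at \<open>j = i\<close>, where \<open>D i i = 0\<close>.\<close>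
  moreover have "d f (D i) = f i" if "f \<in> S" for f i
  proof (rule antisym)
    show "d f (D i) \<le> f i"
    proof (rule d_least[OF that row], rule field_le_epsilon)
      fix j and \<epsilon> :: real assume "0 < \<epsilon>"
      then obtain k where k: "\<And>j. \<bar>f j - D k j\<bar> \<le> \<epsilon> / 2" using near_row[OF \<open>f \<in> S\<close>, of "\<epsilon> / 2"] by auto
      show "\<bar>f j - D i j\<bar> \<le> f i + \<epsilon>"
        using k[of j] k[of i] D_diff[of k j i] by linarith
    qed
    show "f i \<le> d f (D i)"
      using d_upper[OF that row, of i i] D_refl[of i] by simp
  qed
  ultimately show ?thesis
    by (intro that[of "metric (S, d)"]) (auto simp: compact_metric_def S_def[symmetric] intro: d_least)
qed

section \<open>Finite nets in the label space and common nets in the sequence\<close>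

lemma compact_metric_finite_net:
  assumes "compact_metric L" "0 < \<delta>"
  obtains K where "finite K" "K \<subseteq> mspace L" "\<forall>l\<in>mspace L. \<exists>q\<in>K. mdist L l q \<le> \<delta>"
proof -
  interpret L: Metric_space "mspace L" "mdist L" by simp
  have "L.mtotally_bounded (mspace L)"
    using assms(1) by (simp add: compact_metric_def mtopology_of_def L.compact_space_eq_mcomplete_mtotally_bounded)
  then have "\<exists>K. finite K \<and> K \<subseteq> mspace L \<and> mspace L \<subseteq> (\<Union>x\<in>K. L.mball x \<delta>)"
    unfolding L.mtotally_bounded_def using assms(2) by simp
  then obtain K where K: "finite K" "K \<subseteq> mspace L" "mspace L \<subseteq> (\<Union>x\<in>K. L.mball x \<delta>)"
    by (elim exE conjE)
  have "\<exists>q\<in>K. mdist L l q \<le> \<delta>" if "l \<in> mspace L" for l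
    using that K(3) by (force simp: mdist_commute)
  with K show ?thesis using that by blast
qed

lemma metric_diameter_le_iff:
  assumes "0 \<le> d"
  shows "metric_diameter X \<le> ennreal d \<longleftrightarrow> (\<forall>x\<in>mspace X. \<forall>y\<in>mspace X. mdist X x y \<le> d)"
  using assms by (simp add: metric_diameter_def SUP_le_iff)

text \<open>Since the bound on the size of a net at scale \<open>e k\<close> does not depend on
  \<open>n\<close>, each such net can be listed by the indices below \<open>N k\<close>. Putting the
  lists for all \<open>k\<close> into one sequence gives each scale a finite block of indices that
  is the same for every \<open>n\<close>.\<close>

lemma uniformly_totally_bounded_common_nets:
  fixes X :: "nat \<Rightarrow> 'a metric"
  assumes utb: "uniformly_totally_bounded (range X)" and nonempty: "\<And>n. mspace (X n) \<noteq> {}"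
  obtains p :: "nat \<Rightarrow> nat \<Rightarrow> 'a"
  where "\<And>n i. p n i \<in> mspace (X n)"
    and "\<And>\<epsilon>. 0 < \<epsilon> \<Longrightarrow> \<exists>F. finite F \<and> (\<forall>n. \<forall>x\<in>mspace (X n). \<exists>i\<in>F. mdist (X n) x (p n i) \<le> \<epsilon>)"
proof -
  define e where "e k = inverse (real (Suc k))" for k
  have "\<exists>N. \<forall>n. \<exists>S. is_net (e k) (X n) S \<and> finite S \<and> card S \<le> N" for k
    using utb unfolding uniformly_totally_bounded_def e_def by simp
  then obtain N where N: "\<exists>S. is_net (e k) (X n) S \<and> finite S \<and> card S \<le> N k" for k n
    by metis
  define covers where "covers k n h \<longleftrightarrow> (\<forall>i. h i \<in> mspace (X n)) \<and>
    (\<forall>x\<in>mspace (X n). \<exists>i<N k. mdist (X n) x (h i) \<le> e k)" for k n and h :: "nat \<Rightarrow> 'a"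
  have "\<exists>h. covers k n h" for k n
  proof -
    obtain S where net: "is_net (e k) (X n) S" and S: "finite S" "card S \<le> N k" using N by blast
    obtain b where b: "bij_betw b {0..<card S} S" using ex_bij_betw_nat_finite[OF \<open>finite S\<close>] by blast
    obtain x0 where "x0 \<in> mspace (X n)" using nonempty by blast
    \<comment> \<open>Nets with fewer than \<open>N k\<close> points are padded with a repeated
      point, which exists because the space is nonempty.\<close>
    define h where "h i = (if i < card S then b i else x0)" for i
    have "b i \<in> mspace (X n)" if "i < card S" for i
      using b that net by (auto simp: is_net_def bij_betw_def)
    then have "h i \<in> mspace (X n)" for i
      using \<open>x0 \<in> mspace (X n)\<close> by (simp add: h_def)
    moreover have "\<exists>i<N k. mdist (X n) x (h i) \<le> e k" if "x \<in> mspace (X n)" for x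
    proof -
      obtain s where "s \<in> S" and s: "mdist (X n) x s < e k" using net \<open>x \<in> mspace (X n)\<close> unfolding is_net_def by blast
      then obtain i where "i < card S" "b i = s"
        using b by (metis atLeastLessThan_iff bij_betw_imp_surj_on imageE)
      then show ?thesis using s S(2) by (intro exI[of _ i]) (auto simp: h_def)
    qed
    ultimately show ?thesis unfolding covers_def by blast
  qed
  then obtain h where covers: "\<And>k n. covers k n (h k n)" by metis
  then have h: "h k n i \<in> mspace (X n)"
    and h_net: "x \<in> mspace (X n) \<Longrightarrow> \<exists>i<N k. mdist (X n) x (h k n i) \<le> e k" for k n i x
    unfolding covers_def by simp_all
  define p where "p n i = h (fst (prod_decode i)) n (snd (prod_decode i))" for n i
  have "\<exists>F. finite F \<and> (\<forall>n. \<forall>x\<in>mspace (X n). \<exists>i\<in>F. mdist (X n) x (p n i) \<le> \<epsilon>)" if "0 < \<epsilon>" for \<epsilon>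
  proof -
    obtain k where k: "e k < \<epsilon>" using reals_Archimedean[OF \<open>0 < \<epsilon>\<close>] by (auto simp: e_def)
    have "\<exists>i\<in>(\<lambda>j. prod_encode (k, j)) ` {..<N k}. mdist (X n) x (p n i) \<le> \<epsilon>" if "x \<in> mspace (X n)" for n x
      using h_net[OF that, of k] k by (force simp: p_def)
    then show ?thesis by (intro exI[of _ "(\<lambda>j. prod_encode (k, j)) ` {..<N k}"]) auto
  qed
  moreover have "p n i \<in> mspace (X n)" for n i by (simp add: p_def h)
  ultimately show ?thesis using that by blast
qed

section \<open>Extraction of a subsequence with convergent distances\<close>

definition asymptotically_equicontinuous ::
    "'l metric \<Rightarrow> (nat \<Rightarrow> 'a metric) \<Rightarrow> (nat \<Rightarrow> 'l \<Rightarrow> 'a) \<Rightarrow> bool" where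
  "asymptotically_equicontinuous L X \<alpha> \<longleftrightarrow>
     (\<forall>\<epsilon>>0. \<exists>N. \<exists>\<delta>>0. \<forall>n\<ge>N. \<forall>l\<in>mspace L. \<forall>l'\<in>mspace L.
        mdist L l l' \<le> \<delta> \<longrightarrow> mdist (X n) (\<alpha> n l) (\<alpha> n l') \<le> \<epsilon>)"

lemma asymptotically_equicontinuousE:
  assumes "asymptotically_equicontinuous L X \<alpha>" "0 < \<epsilon>"
  obtains N \<delta> where "0 < \<delta>"
    "\<forall>n\<ge>N. \<forall>l\<in>mspace L. \<forall>l'\<in>mspace L. mdist L l l' \<le> \<delta> \<longrightarrow> mdist (X n) (\<alpha> n l) (\<alpha> n l') \<le> \<epsilon>"
  using assms unfolding asymptotically_equicontinuous_def by meson

lemma asymptotically_equicontinuous_subseq: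
  assumes "asymptotically_equicontinuous L X \<alpha>" "strict_mono r"
  shows "asymptotically_equicontinuous L (\<lambda>n. X (r n)) (\<lambda>n. \<alpha> (r n))"
  unfolding asymptotically_equicontinuous_def
proof (intro allI impI)
  fix \<epsilon> :: real assume "0 < \<epsilon>"
  obtain N \<delta> where "0 < \<delta>" and N: "\<forall>n\<ge>N. \<forall>l\<in>mspace L. \<forall>l'\<in>mspace L.
      mdist L l l' \<le> \<delta> \<longrightarrow> mdist (X n) (\<alpha> n l) (\<alpha> n l') \<le> \<epsilon>"
    by (rule asymptotically_equicontinuousE[OF assms(1) \<open>0 < \<epsilon>\<close>])
  have "N \<le> r n" if "N \<le> n" for n
    using seq_suble[OF assms(2), of n] that by simp
  with \<open>0 < \<delta>\<close> N show "\<exists>N. \<exists>\<delta>>0. \<forall>n\<ge>N. \<forall>l\<in>mspace L. \<forall>l'\<in>mspace L.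
      mdist L l l' \<le> \<delta> \<longrightarrow> mdist (X (r n)) (\<alpha> (r n) l) (\<alpha> (r n) l') \<le> \<epsilon>"
    by (intro exI[of _ N] exI[of _ \<delta>]) simp
qed

text \<open>A diagonal argument handles only countably many sequences, while \<open>L\<close> may be
  uncountable. It is therefore applied to a countable dense set \<open>Q\<close> of labels, and
  equicontinuity carries convergence over to the others.\<close>

lemma convergent_distances_subsequence:
  fixes X :: "nat \<Rightarrow> 'a metric" and p :: "nat \<Rightarrow> nat \<Rightarrow> 'a"
  assumes L: "compact_metric L" and \<alpha>: "\<And>n l. l \<in> mspace L \<Longrightarrow> \<alpha> n l \<in> mspace (X n)"
    and equi: "asymptotically_equicontinuous L X \<alpha>"
    and p: "\<And>n i. p n i \<in> mspace (X n)"
    and bounded: "\<And>n x y. \<lbrakk>x \<in> mspace (X n); y \<in> mspace (X n)\<rbrakk> \<Longrightarrow> mdist (X n) x y \<le> B"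
  shows "\<exists>r :: nat \<Rightarrow> nat. strict_mono r \<and>
    (\<forall>i j. convergent (\<lambda>n. mdist (X (r n)) (p (r n) i) (p (r n) j))) \<and>
    (\<forall>l\<in>mspace L. \<forall>i. convergent (\<lambda>n. mdist (X (r n)) (\<alpha> (r n) l) (p (r n) i)))"
proof -
  have "\<exists>K. finite K \<and> K \<subseteq> mspace L \<and> (\<forall>l\<in>mspace L. \<exists>q\<in>K. mdist L l q \<le> inverse (real (Suc k)))" for k
    by (rule compact_metric_finite_net[OF L, of "inverse (real (Suc k))"]) auto
  then obtain K where "\<forall>k. finite (K k) \<and> K k \<subseteq> mspace L \<and>
      (\<forall>l\<in>mspace L. \<exists>q\<in>K k. mdist L l q \<le> inverse (real (Suc k)))"
    using choice[of "\<lambda>k K. finite K \<and> K \<subseteq> mspace L \<and> (\<forall>l\<in>mspace L. \<exists>q\<in>K. mdist L l q \<le> inverse (real (Suc k)))"]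
    by blast
  then have K: "finite (K k)" "K k \<subseteq> mspace L"
    and K_net: "l \<in> mspace L \<Longrightarrow> \<exists>q\<in>K k. mdist L l q \<le> inverse (real (Suc k))" for k l
    by simp_all
  define Q where "Q = (\<Union>k. K k)"
  have "Q \<subseteq> mspace L" "countable Q"
    using K by (auto simp: Q_def intro: countable_finite)
  \<comment> \<open>The sum type joins net points and labels from \<open>Q\<close> into one
    countable index set, so that a single extraction serves both families of distances.\<close>
  define f where "f n = (\<lambda>(u, i). mdist (X n) (case_sum (p n) (\<alpha> n) u) (p n i))" for n
  obtain r where "strict_mono r"
    and r: "\<And>z. z \<in> (UNIV <+> Q) \<times> UNIV \<Longrightarrow> \<exists>c. (\<lambda>n. f (r n) z) \<longlonglongrightarrow> c"
  proof (rule function_convergent_subsequence[of "(UNIV <+> Q) \<times> UNIV" f B])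
    show "countable (((UNIV :: nat set) <+> Q) \<times> (UNIV :: nat set))" using \<open>countable Q\<close> by (simp add: Plus_def)
    show "norm (f n z) \<le> B" if "z \<in> (UNIV <+> Q) \<times> UNIV" for n z
      using that \<open>Q \<subseteq> mspace L\<close> by (auto simp: f_def intro!: bounded p \<alpha>)
  qed blast
  have "convergent (\<lambda>n. mdist (X (r n)) (p (r n) i) (p (r n) j))" for i j
    using r[of "(Inl i, j)"] by (auto simp: f_def convergent_def)
  \<comment> \<open>No candidate for the limit is at hand, so the Cauchy property is shown.
    Replacing \<open>l\<close> by a nearby \<open>q\<close> at both indices costs
    \<open>\<epsilon> / 4\<close> each, and the sequence for \<open>q\<close> varies by less than
    \<open>\<epsilon> / 4\<close>.\<close>
  moreover have "convergent (\<lambda>n. mdist (X (r n)) (\<alpha> (r n) l) (p (r n) i))" if l: "l \<in> mspace L" for l i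
    unfolding Cauchy_convergent_iff[symmetric]
  proof (rule metric_CauchyI)
    fix \<epsilon> :: real assume "0 < \<epsilon>"
    obtain N \<delta> where "0 < \<delta>" and N: "\<forall>n\<ge>N. \<forall>l\<in>mspace L. \<forall>l'\<in>mspace L.
        mdist L l l' \<le> \<delta> \<longrightarrow> mdist (X n) (\<alpha> n l) (\<alpha> n l') \<le> \<epsilon> / 4"
      by (rule asymptotically_equicontinuousE[OF equi, of "\<epsilon> / 4"]) (use \<open>0 < \<epsilon>\<close> in auto)
    obtain k where k: "inverse (real (Suc k)) < \<delta>" using reals_Archimedean[OF \<open>0 < \<delta>\<close>] by blast
    obtain q where q: "q \<in> Q" "mdist L l q \<le> \<delta>"
      using K_net[OF l, of k] k unfolding Q_def by fastforce
    have "Cauchy (\<lambda>n. mdist (X (r n)) (\<alpha> (r n) q) (p (r n) i))"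
      unfolding Cauchy_convergent_iff using r[of "(Inr q, i)"] q(1) by (auto simp: f_def convergent_def)
    then obtain M where M: "\<And>m n. \<lbrakk>M \<le> m; M \<le> n\<rbrakk> \<Longrightarrow>
        \<bar>mdist (X (r m)) (\<alpha> (r m) q) (p (r m) i) - mdist (X (r n)) (\<alpha> (r n) q) (p (r n) i)\<bar> < \<epsilon> / 4"
      using \<open>0 < \<epsilon>\<close> unfolding Cauchy_def dist_real_def by (meson divide_pos_pos zero_less_numeral)
    have near: "\<bar>mdist (X (r n)) (\<alpha> (r n) l) (p (r n) i) - mdist (X (r n)) (\<alpha> (r n) q) (p (r n) i)\<bar> \<le> \<epsilon> / 4"
      if "N \<le> n" for n
    proof -
      have "q \<in> mspace L" using q \<open>Q \<subseteq> mspace L\<close> by blast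
      then have "mdist (X (r n)) (\<alpha> (r n) l) (\<alpha> (r n) q) \<le> \<epsilon> / 4"
        using N l q(2) seq_suble[OF \<open>strict_mono r\<close>, of n] that by simp
      then show ?thesis
        using abs_mdist_diff_le[OF \<alpha>[OF l] \<alpha>[OF \<open>q \<in> mspace L\<close>] p] by (rule order_trans[rotated])
    qed
    show "\<exists>M. \<forall>m\<ge>M. \<forall>n\<ge>M. dist (mdist (X (r m)) (\<alpha> (r m) l) (p (r m) i))
        (mdist (X (r n)) (\<alpha> (r n) l) (p (r n) i)) < \<epsilon>"
    proof (intro exI[of _ "max M N"] allI impI)
      fix m n assume mn: "max M N \<le> m" "max M N \<le> n"
      show "dist (mdist (X (r m)) (\<alpha> (r m) l) (p (r m) i)) (mdist (X (r n)) (\<alpha> (r n) l) (p (r n) i)) < \<epsilon>"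
        using near[of m] near[of n] M[of m n] mn unfolding dist_real_def max.bounded_iff by linarith
    qed
  qed
  ultimately show ?thesis using \<open>strict_mono r\<close> by blast
qed

section \<open>Convergence to the limit space\<close>

lemma LGH_convergent_of_distances:
  fixes L :: "'l metric" and X :: "nat \<Rightarrow> 'a metric" and p :: "nat \<Rightarrow> nat \<Rightarrow> 'a"
  assumes L: "compact_metric L" and \<alpha>: "\<And>n l. l \<in> mspace L \<Longrightarrow> \<alpha> n l \<in> mspace (X n)"
    and equi: "asymptotically_equicontinuous L X \<alpha>"
    and p: "\<And>n i. p n i \<in> mspace (X n)"
    and bounded: "\<And>n x y. \<lbrakk>x \<in> mspace (X n); y \<in> mspace (X n)\<rbrakk> \<Longrightarrow> mdist (X n) x y \<le> B"
    and nets: "\<And>\<epsilon>. 0 < \<epsilon> \<Longrightarrow> \<exists>F. finite F \<and> (\<forall>n. \<forall>x\<in>mspace (X n). \<exists>i\<in>F. mdist (X n) x (p n i) \<le> \<epsilon>)"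
    and conv_p: "\<And>i j. convergent (\<lambda>n. mdist (X n) (p n i) (p n j))"
    and conv_\<alpha>: "\<And>l i. l \<in> mspace L \<Longrightarrow> convergent (\<lambda>n. mdist (X n) (\<alpha> n l) (p n i))"
  shows "\<exists>(Y :: (nat \<Rightarrow> real) metric) (\<beta> :: 'l \<Rightarrow> nat \<Rightarrow> real).
    labeled_metric_space (mspace L) Y \<beta> \<and>
    continuous_map (mtopology_of L) (mtopology_of Y) \<beta> \<and>
    (\<lambda>n. LGH_distance (mspace L) (X n) (\<alpha> n) Y \<beta>) \<longlonglongrightarrow> 0"
proof -
  define D where "D i j = lim (\<lambda>n. mdist (X n) (p n i) (p n j))" for i j
  define \<beta> where "\<beta> l i = lim (\<lambda>n. mdist (X n) (\<alpha> n l) (p n i))" for l i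
  have D: "(\<lambda>n. mdist (X n) (p n i) (p n j)) \<longlonglongrightarrow> D i j" for i j
    unfolding D_def using conv_p by (simp add: convergent_LIMSEQ_iff)
  have \<beta>: "(\<lambda>n. mdist (X n) (\<alpha> n l) (p n i)) \<longlonglongrightarrow> \<beta> l i" if "l \<in> mspace L" for l i
    unfolding \<beta>_def using conv_\<alpha>[OF that] by (simp add: convergent_LIMSEQ_iff)
  have "pseudometric_on UNIV D"
    unfolding pseudometric_on_def
  proof (intro conjI ballI)
    fix i j k
    show "0 \<le> D i j" by (rule LIMSEQ_le_const[OF D]) auto
    have "mdist (X n) (p n i) (p n i) = 0" for n using p by simp
    then show "D i i = 0" using D[of i i] by (simp add: LIMSEQ_const_iff)
    show "D i j = D j i" using D[of i j] D[of j i] by (simp add: mdist_commute LIMSEQ_unique)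
    show "D i k \<le> D i j + D j k"
      by (rule LIMSEQ_le[OF D tendsto_add[OF D D]]) (auto intro!: mdist_triangle p)
  qed
  moreover have "D i j \<le> B" for i j
    by (rule LIMSEQ_le_const2[OF D]) (use p bounded in blast)
  moreover have "\<exists>F. finite F \<and> (\<forall>i. \<exists>j\<in>F. D i j \<le> \<epsilon>)" if "0 < \<epsilon>" for \<epsilon>
  proof -
    obtain F where "finite F" and F: "\<And>n x. x \<in> mspace (X n) \<Longrightarrow> \<exists>i\<in>F. mdist (X n) x (p n i) \<le> \<epsilon>"
      using nets[OF \<open>0 < \<epsilon>\<close>] by blast
    have "\<exists>j\<in>F. D i j \<le> \<epsilon>" for i
      by (rule finite_cover_limit[OF \<open>finite F\<close> D]) (use F p in blast)
    then show ?thesis using \<open>finite F\<close> by blast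
  qed
  ultimately obtain Y where "compact_metric Y"
    and Y: "mspace Y = {f. \<forall>\<epsilon>>0. \<exists>i. \<forall>j. \<bar>f j - D i j\<bar> \<le> \<epsilon>}"
    and "\<forall>f\<in>mspace Y. \<forall>i. mdist Y f (D i) = f i"
    and dist_all: "\<forall>f\<in>mspace Y. \<forall>g\<in>mspace Y. \<forall>\<epsilon>. (\<forall>j. \<bar>f j - g j\<bar> \<le> \<epsilon>) \<longrightarrow> mdist Y f g \<le> \<epsilon>"
    by (rule compact_limit_space)
  then have dist_row: "mdist Y f (D i) = f i" if "f \<in> mspace Y" for f i
    using that by blast
  have dist_le: "mdist Y f g \<le> \<epsilon>" if "f \<in> mspace Y" "g \<in> mspace Y" "\<And>j. \<bar>f j - g j\<bar> \<le> \<epsilon>" for f g \<epsilon>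
    using dist_all that by blast
  have row: "D i \<in> mspace Y" for i
    unfolding Y by (auto intro!: exI[of _ i])
  \<comment> \<open>Limit of the triangle inequality in \<open>X n\<close>. It turns smallness of
    the one number \<open>\<beta> l i\<close> into uniform closeness of \<open>\<beta> l\<close> to
    row \<open>i\<close>, which is what membership in \<open>Y\<close> asks for.\<close>
  have \<beta>_near_row: "\<bar>\<beta> l j - D i j\<bar> \<le> \<beta> l i" if "l \<in> mspace L" for l i j
    by (rule LIMSEQ_le[OF tendsto_rabs[OF tendsto_diff[OF \<beta>[OF that] D]] \<beta>[OF that]])
      (use that in \<open>auto intro!: abs_mdist_diff_le \<alpha> p\<close>)
  have \<beta>_Y: "\<beta> l \<in> mspace Y" if l: "l \<in> mspace L" for l
    unfolding Y
  proof (intro CollectI allI impI)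
    fix \<epsilon> :: real assume "0 < \<epsilon>"
    obtain F where "finite F" and F: "\<And>n x. x \<in> mspace (X n) \<Longrightarrow> \<exists>i\<in>F. mdist (X n) x (p n i) \<le> \<epsilon>"
      using nets[OF \<open>0 < \<epsilon>\<close>] by blast
    have "\<exists>i\<in>F. \<beta> l i \<le> \<epsilon>"
      by (rule finite_cover_limit[OF \<open>finite F\<close> \<beta>[OF l]]) (use F \<alpha>[OF l] in blast)
    then show "\<exists>i. \<forall>j. \<bar>\<beta> l j - D i j\<bar> \<le> \<epsilon>"
      using \<beta>_near_row[OF l] order_trans by blast
  qed
  \<comment> \<open>In the limit the restriction to large \<open>n\<close> disappears. The bound is
    uniform in \<open>i\<close>, hence a bound on the metric of \<open>Y\<close>, which gives
    continuity of \<open>\<beta>\<close>.\<close>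
  have \<beta>_equi: "\<exists>\<delta>>0. \<forall>l\<in>mspace L. \<forall>l'\<in>mspace L. mdist L l l' \<le> \<delta> \<longrightarrow> (\<forall>i. \<bar>\<beta> l i - \<beta> l' i\<bar> \<le> \<epsilon>)"
    if "0 < \<epsilon>" for \<epsilon>
  proof -
    obtain N \<delta> where "0 < \<delta>" and N: "\<forall>n\<ge>N. \<forall>l\<in>mspace L. \<forall>l'\<in>mspace L.
        mdist L l l' \<le> \<delta> \<longrightarrow> mdist (X n) (\<alpha> n l) (\<alpha> n l') \<le> \<epsilon>"
      by (rule asymptotically_equicontinuousE[OF equi \<open>0 < \<epsilon>\<close>])
    have "\<bar>\<beta> l i - \<beta> l' i\<bar> \<le> \<epsilon>" if l: "l \<in> mspace L" "l' \<in> mspace L" "mdist L l l' \<le> \<delta>" for l l' i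
    proof (rule LIMSEQ_le_const2[OF tendsto_rabs[OF tendsto_diff[OF \<beta> \<beta>]]])
      have "\<bar>mdist (X n) (\<alpha> n l) (p n i) - mdist (X n) (\<alpha> n l') (p n i)\<bar> \<le> \<epsilon>" if "N \<le> n" for n
        using abs_mdist_diff_le[OF \<alpha>[OF l(1)] \<alpha>[OF l(2)] p] N l that by (meson order_trans)
      then show "\<exists>N. \<forall>n\<ge>N. \<bar>mdist (X n) (\<alpha> n l) (p n i) - mdist (X n) (\<alpha> n l') (p n i)\<bar> \<le> \<epsilon>"
        by blast
    qed (use l in auto)
    then show ?thesis using \<open>0 < \<delta>\<close> by blast
  qed
  have cont: "continuous_map (mtopology_of L) (mtopology_of Y) \<beta>"
  proof -
    interpret L: Metric_space "mspace L" "mdist L" by simp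
    have "\<exists>\<delta>>0. \<forall>l'. l' \<in> mspace L \<and> mdist L l l' < \<delta> \<longrightarrow> mdist Y (\<beta> l) (\<beta> l') < \<epsilon>"
      if l: "l \<in> mspace L" and "0 < \<epsilon>" for l \<epsilon>
    proof -
      obtain \<delta> where "0 < \<delta>" and \<delta>: "\<forall>l\<in>mspace L. \<forall>l'\<in>mspace L.
          mdist L l l' \<le> \<delta> \<longrightarrow> (\<forall>i. \<bar>\<beta> l i - \<beta> l' i\<bar> \<le> \<epsilon> / 2)"
        using \<beta>_equi[of "\<epsilon> / 2"] \<open>0 < \<epsilon>\<close> by auto
      have "mdist Y (\<beta> l) (\<beta> l') < \<epsilon>" if l': "l' \<in> mspace L" "mdist L l l' < \<delta>" for l'
      proof -
        have "mdist Y (\<beta> l) (\<beta> l') \<le> \<epsilon> / 2"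
          using \<delta> l l' by (intro dist_le \<beta>_Y) auto
        then show ?thesis using \<open>0 < \<epsilon>\<close> by simp
      qed
      then show ?thesis using \<open>0 < \<delta>\<close> by blast
    qed
    then show ?thesis
      unfolding mtopology_of_def using \<beta>_Y
      by (subst L.metric_continuous_map[of "mspace Y" "mdist Y"]) auto
  qed
  \<comment> \<open>Each label is moved to a point \<open>q\<close> of a finite net of
    \<open>L\<close>, where convergence is uniform because there are finitely many \<open>q\<close>.
    Moving costs \<open>\<epsilon> / 3\<close> in \<open>X n\<close> and
    \<open>\<epsilon> / 3\<close> in the limit.\<close>
  have \<beta>_uniform: "\<forall>\<^sub>F n in sequentially. \<forall>l\<in>mspace L. \<bar>mdist (X n) (\<alpha> n l) (p n i) - \<beta> l i\<bar> \<le> \<epsilon>"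
    if \<epsilon>: "0 < \<epsilon>" for \<epsilon> i
  proof -
    have "0 < \<epsilon> / 3" using \<epsilon> by simp
    obtain N \<delta> where "0 < \<delta>" and N: "\<forall>n\<ge>N. \<forall>l\<in>mspace L. \<forall>l'\<in>mspace L.
        mdist L l l' \<le> \<delta> \<longrightarrow> mdist (X n) (\<alpha> n l) (\<alpha> n l') \<le> \<epsilon> / 3"
      by (rule asymptotically_equicontinuousE[OF equi \<open>0 < \<epsilon> / 3\<close>])
    obtain \<delta>' where "0 < \<delta>'" and \<delta>': "\<forall>l\<in>mspace L. \<forall>l'\<in>mspace L.
        mdist L l l' \<le> \<delta>' \<longrightarrow> (\<forall>i. \<bar>\<beta> l i - \<beta> l' i\<bar> \<le> \<epsilon> / 3)"
      using \<beta>_equi[OF \<open>0 < \<epsilon> / 3\<close>] by auto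
    have "0 < min \<delta> \<delta>'" using \<open>0 < \<delta>\<close> \<open>0 < \<delta>'\<close> by simp
    then obtain K where "finite K" "K \<subseteq> mspace L"
      and K: "\<forall>l\<in>mspace L. \<exists>q\<in>K. mdist L l q \<le> min \<delta> \<delta>'"
      by (rule compact_metric_finite_net[OF L])
    have "\<forall>\<^sub>F n in sequentially. \<bar>mdist (X n) (\<alpha> n q) (p n i) - \<beta> q i\<bar> < \<epsilon> / 3" if "q \<in> K" for q
      using tendstoD[OF \<beta> \<open>0 < \<epsilon> / 3\<close>, of q i] that \<open>K \<subseteq> mspace L\<close> by (auto simp: dist_real_def)
    then have "\<forall>\<^sub>F n in sequentially. \<forall>q\<in>K. \<bar>mdist (X n) (\<alpha> n q) (p n i) - \<beta> q i\<bar> < \<epsilon> / 3"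
      using \<open>finite K\<close> by (simp add: eventually_ball_finite)
    then show ?thesis
      using eventually_ge_at_top[of N]
    proof eventually_elim
      case (elim n)
      show ?case
      proof
        fix l assume l: "l \<in> mspace L"
        obtain q where "q \<in> K" and q: "mdist L l q \<le> min \<delta> \<delta>'" using K l by blast
        have "q \<in> mspace L" using \<open>q \<in> K\<close> \<open>K \<subseteq> mspace L\<close> by blast
        have "\<bar>mdist (X n) (\<alpha> n l) (p n i) - mdist (X n) (\<alpha> n q) (p n i)\<bar> \<le> mdist (X n) (\<alpha> n l) (\<alpha> n q)"
          by (intro abs_mdist_diff_le \<alpha> p l \<open>q \<in> mspace L\<close>)
        moreover have "mdist (X n) (\<alpha> n l) (\<alpha> n q) \<le> \<epsilon> / 3"
          using N elim(2) l \<open>q \<in> mspace L\<close> q by simp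
        moreover have "\<bar>\<beta> l i - \<beta> q i\<bar> \<le> \<epsilon> / 3"
          using \<delta>' l \<open>q \<in> mspace L\<close> q by simp
        moreover have "\<bar>mdist (X n) (\<alpha> n q) (p n i) - \<beta> q i\<bar> < \<epsilon> / 3"
          using elim(1) \<open>q \<in> K\<close> by blast
        ultimately show "\<bar>mdist (X n) (\<alpha> n l) (p n i) - \<beta> l i\<bar> \<le> \<epsilon>" by linarith
      qed
    qed
  qed
  have LGH_small: "\<forall>\<^sub>F n in sequentially. LGH_distance (mspace L) (X n) (\<alpha> n) Y \<beta> \<le> ennreal (4 * \<epsilon>)"
    if \<epsilon>: "0 < \<epsilon>" for \<epsilon>
  proof -
    obtain F where "finite F" and F: "\<And>n x. x \<in> mspace (X n) \<Longrightarrow> \<exists>i\<in>F. mdist (X n) x (p n i) \<le> \<epsilon>"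
      using nets[OF \<epsilon>] by blast
    have F_Y: "\<exists>i\<in>F. mdist Y f (D i) \<le> 2 * \<epsilon>" if "f \<in> mspace Y" for f
    proof -
      obtain k where k: "\<And>j. \<bar>f j - D k j\<bar> \<le> \<epsilon>" using \<open>f \<in> mspace Y\<close> \<epsilon> unfolding Y by blast
      have "\<exists>i\<in>F. D k i \<le> \<epsilon>"
        by (rule finite_cover_limit[OF \<open>finite F\<close> D]) (use F p in blast)
      then obtain i where "i \<in> F" "D k i \<le> \<epsilon>" by blast
      then have "f i \<le> 2 * \<epsilon>" using k[of i] by linarith
      then show ?thesis using dist_row[OF that] \<open>i \<in> F\<close> by auto
    qed
    have "\<forall>\<^sub>F n in sequentially. \<bar>mdist (X n) (p n i) (p n j) - D i j\<bar> < \<epsilon>" for i j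
      using tendstoD[OF D \<epsilon>] by (simp add: dist_real_def)
    then have "\<forall>\<^sub>F n in sequentially. \<forall>i\<in>F. \<forall>j\<in>F. \<bar>mdist (X n) (p n i) (p n j) - D i j\<bar> < \<epsilon>"
      using \<open>finite F\<close> by (simp add: eventually_ball_finite)
    moreover have "\<forall>\<^sub>F n in sequentially. \<forall>i\<in>F. \<forall>l\<in>mspace L. \<bar>mdist (X n) (\<alpha> n l) (p n i) - \<beta> l i\<bar> \<le> \<epsilon>"
      using \<open>finite F\<close> \<beta>_uniform[OF \<epsilon>] by (simp add: eventually_ball_finite)
    ultimately show ?thesis
    proof eventually_elim
      case (elim n)
      \<comment> \<open>The tolerance on the side of \<open>Y\<close> is doubled for two reasons: an
        arbitrary point of \<open>Y\<close> is first replaced by a row and then by a row from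
        \<open>F\<close>, and the limit of a label distance that is at most
        \<open>\<epsilon>\<close> at stage \<open>n\<close> is only known to be at most
        \<open>2 * \<epsilon>\<close>.\<close>
      define R where "R = {(x, y). x \<in> mspace (X n) \<and> y \<in> mspace Y \<and>
        (\<exists>i\<in>F. mdist (X n) x (p n i) \<le> \<epsilon> \<and> mdist Y y (D i) \<le> 2 * \<epsilon>)}"
      have left: "\<exists>y. (x, y) \<in> R" if "x \<in> mspace (X n)" for x
      proof -
        obtain i where "i \<in> F" "mdist (X n) x (p n i) \<le> \<epsilon>" using F \<open>x \<in> mspace (X n)\<close> by blast
        moreover have "mdist Y (D i) (D i) \<le> 2 * \<epsilon>" using mdist_zero[OF row row, of i i] \<epsilon> by simp
        ultimately show ?thesis using row \<open>x \<in> mspace (X n)\<close> unfolding R_def by blast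
      qed
      show ?case
      proof (rule LGH_distance_le_correspondence[of R])
        show "R \<noteq> {}" using left[OF p] by blast
        show "R \<subseteq> mspace (X n) \<times> mspace Y" unfolding R_def by blast
        show "0 \<le> 4 * \<epsilon>" using \<epsilon> by simp
        show "\<exists>y. (x, y) \<in> R" if "x \<in> mspace (X n)" for x using left[OF that] .
        show "\<exists>x. (x, y) \<in> R" if "y \<in> mspace Y" for y
        proof -
          obtain i where "i \<in> F" "mdist Y y (D i) \<le> 2 * \<epsilon>" using F_Y \<open>y \<in> mspace Y\<close> by blast
          moreover have "mdist (X n) (p n i) (p n i) \<le> \<epsilon>" using mdist_zero[OF p p, of n i i] \<epsilon> by simp
          ultimately show ?thesis using p \<open>y \<in> mspace Y\<close> unfolding R_def by blast
        qed
        show "(\<alpha> n l, \<beta> l) \<in> R" if l: "l \<in> mspace L" for l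
        proof -
          obtain i where "i \<in> F" and i: "mdist (X n) (\<alpha> n l) (p n i) \<le> \<epsilon>" using F \<alpha>[OF l] by blast
          have "\<bar>mdist (X n) (\<alpha> n l) (p n i) - \<beta> l i\<bar> \<le> \<epsilon>" using elim(2) \<open>i \<in> F\<close> l by blast
          then have "\<beta> l i \<le> 2 * \<epsilon>" using i by linarith
          then show ?thesis using \<open>i \<in> F\<close> i \<alpha>[OF l] \<beta>_Y[OF l] dist_row[OF \<beta>_Y[OF l]] unfolding R_def by auto
        qed
        \<comment> \<open>Passing to net points costs \<open>2 * \<epsilon>\<close> in
          \<open>X n\<close> and \<open>4 * \<epsilon>\<close> in \<open>Y\<close>, and the
          distances between net points differ by less than \<open>\<epsilon>\<close>. The total of
          \<open>7 * \<epsilon>\<close> is within the allowed \<open>8 * \<epsilon>\<close>.\<close>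
        show "\<bar>mdist (X n) x x' - mdist Y y y'\<bar> \<le> 2 * (4 * \<epsilon>)" if xy: "(x, y) \<in> R" "(x', y') \<in> R" for x y x' y'
        proof -
          obtain i where i: "i \<in> F" "mdist (X n) x (p n i) \<le> \<epsilon>" "mdist Y y (D i) \<le> 2 * \<epsilon>"
            using xy(1) unfolding R_def by blast
          obtain j where j: "j \<in> F" "mdist (X n) x' (p n j) \<le> \<epsilon>" "mdist Y y' (D j) \<le> 2 * \<epsilon>"
            using xy(2) unfolding R_def by blast
          have m: "x \<in> mspace (X n)" "x' \<in> mspace (X n)" "y \<in> mspace Y" "y' \<in> mspace Y"
            using xy unfolding R_def by blast+
          have "\<bar>mdist (X n) x x' - mdist (X n) (p n i) (p n j)\<bar> \<le> 2 * \<epsilon>"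
            using abs_mdist_diff_le[OF m(1) p m(2), of i] abs_mdist_diff_le[OF m(2) p[of n j] p[of n i]] i j
            by (simp add: mdist_commute)
          moreover have "\<bar>mdist Y y y' - mdist Y (D i) (D j)\<bar> \<le> 4 * \<epsilon>"
            using abs_mdist_diff_le[OF m(3) row m(4), of i] abs_mdist_diff_le[OF m(4) row[of j] row[of i]] i j
            by (simp add: mdist_commute)
          moreover have "mdist Y (D i) (D j) = D i j" using dist_row[OF row] .
          moreover have "\<bar>mdist (X n) (p n i) (p n j) - D i j\<bar> < \<epsilon>" using elim(1) i j by blast
          ultimately show ?thesis by linarith
        qed
      qed
    qed
  qed
  have lim: "(\<lambda>n. LGH_distance (mspace L) (X n) (\<alpha> n) Y \<beta>) \<longlonglongrightarrow> 0"
  proof (rule order_tendstoI)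
    fix c :: ennreal assume "0 < c"
    \<comment> \<open>Since \<open>c\<close> may be infinite, a finite value below it is
      used.\<close>
    then obtain e where "0 < e" "e < c" using dense by blast
    obtain x where x: "0 \<le> x" "e = ennreal x"
      using \<open>e < c\<close> by (cases e) auto
    with \<open>0 < e\<close> have "0 < x / 4" by simp
    from LGH_small[OF this]
    show "\<forall>\<^sub>F n in sequentially. LGH_distance (mspace L) (X n) (\<alpha> n) Y \<beta> < c"
      by (rule eventually_mono) (use x \<open>e < c\<close> in auto)
  qed auto
  have "labeled_metric_space (mspace L) Y \<beta>"
    using \<open>compact_metric Y\<close> \<beta>_Y by (auto simp: labeled_metric_space_def)
  then show ?thesis using cont lim by blast
qed

section \<open>The theorem, with empty spaces treated separately\<close>

theorem theorem4p5:
  fixes L :: "'l metric"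
    and X :: "nat \<Rightarrow> 'a metric"
    and \<alpha> :: "nat \<Rightarrow> 'l \<Rightarrow> 'a"
  assumes "compact_metric L"
    and "\<And>n. labeled_metric_space (mspace L) (X n) (\<alpha> n)"
    and "uniformly_totally_bounded (range X)"
    and "\<And>\<epsilon>::real. \<epsilon> > 0 \<Longrightarrow>
           \<exists>N::nat. \<exists>\<delta>>0. \<forall>n\<ge>N. \<forall>l\<in>mspace L. \<forall>l'\<in>mspace L.
             mdist L l l' \<le> \<delta> \<longrightarrow> mdist (X n) (\<alpha> n l) (\<alpha> n l') \<le> \<epsilon>"
  shows "\<exists>(r :: nat \<Rightarrow> nat) (Y :: (nat \<Rightarrow> real) metric) (\<beta> :: 'l \<Rightarrow> nat \<Rightarrow> real).
           strict_mono r \<and>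
           labeled_metric_space (mspace L) Y \<beta> \<and>
           continuous_map (mtopology_of L) (mtopology_of Y) \<beta> \<and>
           (\<lambda>k. LGH_distance (mspace L) (X (r k)) (\<alpha> (r k)) Y \<beta>) \<longlonglongrightarrow> 0"
proof (cases "infinite {n. mspace (X n) \<noteq> {}}")
  case True
  \<comment> \<open>Common nets need a point in every space, so the nonempty spaces are selected
    first. The points \<open>p n i\<close> lie in \<open>X (s n)\<close>, and the final subsequence
    is the composition of \<open>s\<close> and \<open>r\<close>.\<close>
  then obtain s :: "nat \<Rightarrow> nat" where "strict_mono s" and s: "\<And>n. mspace (X (s n)) \<noteq> {}"
    using infinite_enumerate[OF True] by auto
  have \<alpha>: "\<alpha> n l \<in> mspace (X n)" if "l \<in> mspace L" for n l
    using assms(2)[of n] that by (auto simp: labeled_metric_space_def)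
  have equi: "asymptotically_equicontinuous L X \<alpha>"
    using assms(4) by (simp add: asymptotically_equicontinuous_def)
  obtain B where "0 < B" "\<And>n. metric_diameter (X n) \<le> ennreal B"
    using assms(3) by (auto simp: uniformly_totally_bounded_def)
  then have bounded: "mdist (X n) x y \<le> B" if "x \<in> mspace (X n)" "y \<in> mspace (X n)" for n x y
    using metric_diameter_le_iff[of B "X n"] that by simp
  have "uniformly_totally_bounded (range (\<lambda>n. X (s n)))"
    using assms(3) unfolding uniformly_totally_bounded_def by simp meson
  from uniformly_totally_bounded_common_nets[OF this s]
  obtain p :: "nat \<Rightarrow> nat \<Rightarrow> 'a" where p: "\<And>n i. p n i \<in> mspace (X (s n))"
    and nets: "\<And>\<epsilon>. 0 < \<epsilon> \<Longrightarrow> \<exists>F. finite F \<and> (\<forall>n. \<forall>x\<in>mspace (X (s n)). \<exists>i\<in>F. mdist (X (s n)) x (p n i) \<le> \<epsilon>)"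
    by blast
  have "\<exists>r. strict_mono r \<and>
    (\<forall>i j. convergent (\<lambda>n. mdist (X (s (r n))) (p (r n) i) (p (r n) j))) \<and>
    (\<forall>l\<in>mspace L. \<forall>i. convergent (\<lambda>n. mdist (X (s (r n))) (\<alpha> (s (r n)) l) (p (r n) i)))"
    using asymptotically_equicontinuous_subseq[OF equi \<open>strict_mono s\<close>] bounded
    by (intro convergent_distances_subsequence[where X = "\<lambda>n. X (s n)" and \<alpha> = "\<lambda>n. \<alpha> (s n)" and B = B]
        assms(1) \<alpha> p) auto
  then obtain r where "strict_mono r"
    and conv_p: "\<forall>i j. convergent (\<lambda>n. mdist (X (s (r n))) (p (r n) i) (p (r n) j))"
    and conv_\<alpha>: "\<forall>l\<in>mspace L. \<forall>i. convergent (\<lambda>n. mdist (X (s (r n))) (\<alpha> (s (r n)) l) (p (r n) i))"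
    by blast
  have sr: "strict_mono (\<lambda>n. s (r n))"
    using strict_mono_o[OF \<open>strict_mono s\<close> \<open>strict_mono r\<close>] by (simp add: o_def)
  have nets_r: "\<exists>F. finite F \<and> (\<forall>n. \<forall>x\<in>mspace (X (s (r n))). \<exists>i\<in>F. mdist (X (s (r n))) x (p (r n) i) \<le> \<epsilon>)"
    if "0 < \<epsilon>" for \<epsilon>
    using nets[OF that] by blast
  have "\<exists>(Y :: (nat \<Rightarrow> real) metric) (\<beta> :: 'l \<Rightarrow> nat \<Rightarrow> real).
    labeled_metric_space (mspace L) Y \<beta> \<and>
    continuous_map (mtopology_of L) (mtopology_of Y) \<beta> \<and>
    (\<lambda>n. LGH_distance (mspace L) (X (s (r n))) (\<alpha> (s (r n))) Y \<beta>) \<longlonglongrightarrow> 0"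
  proof (rule LGH_convergent_of_distances[where X = "\<lambda>n. X (s (r n))" and \<alpha> = "\<lambda>n. \<alpha> (s (r n))"
        and p = "\<lambda>n. p (r n)" and B = B])
    show "asymptotically_equicontinuous L (\<lambda>n. X (s (r n))) (\<lambda>n. \<alpha> (s (r n)))"
      using asymptotically_equicontinuous_subseq[OF equi sr] .
  qed (use assms(1) \<alpha> p bounded nets_r conv_p conv_\<alpha> in auto)
  then show ?thesis using sr by blast
next
  \<comment> \<open>Infinitely many of the spaces are empty, which forces \<open>L\<close> to be empty as well.\<close>
  case False
  then have "infinite (UNIV - {n. mspace (X n) \<noteq> {}})"
    by (intro Diff_infinite_finite) auto
  also have "UNIV - {n. mspace (X n) \<noteq> {}} = {n. mspace (X n) = {}}" by auto
  finally have "infinite {n. mspace (X n) = {}}" .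
  from infinite_enumerate[OF this]
  obtain r :: "nat \<Rightarrow> nat" where "strict_mono r" and r: "\<And>n. mspace (X (r n)) = {}"
    by auto
  then have "mspace L = {}"
    using assms(2)[of "r 0"] by (auto simp: labeled_metric_space_def)
  \<comment> \<open>The limit has to be empty, since an empty and a nonempty space are at infinite
    distance.\<close>
  define Y :: "(nat \<Rightarrow> real) metric" where "Y = metric ({}, \<lambda>_ _. 0)"
  have "mspace Y = {}"
    unfolding Y_def by (subst Metric_space.mspace_metric) (auto simp: Metric_space_def)
  have "labeled_metric_space (mspace L) Y (\<lambda>_ _. 0)"
    using \<open>mspace L = {}\<close> \<open>mspace Y = {}\<close>
    by (simp add: labeled_metric_space_def compact_metric_def compact_space_def)
  moreover have "continuous_map (mtopology_of L) (mtopology_of Y) (\<lambda>_ _. 0)"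
    using \<open>mspace L = {}\<close> by (simp flip: null_topspace_iff_trivial)
  moreover have "LGH_distance (mspace L) (X (r n)) (\<alpha> (r n)) Y (\<lambda>_ _. 0) = 0" for n
  proof -
    have "admissible 0 (mspace L) (X (r n)) (\<alpha> (r n)) Y (\<lambda>_ _. 0) (\<lambda>_ _. 0)"
      using r \<open>mspace L = {}\<close> \<open>mspace Y = {}\<close>
      by (simp add: admissible_def pseudometric_on_def hausdorff_distance_def bot_ennreal)
    then have "LGH_distance (mspace L) (X (r n)) (\<alpha> (r n)) Y (\<lambda>_ _. 0) \<le> ennreal 0"
      unfolding LGH_distance_def by (intro Inf_lower) blast
    then show ?thesis by simp
  qed
  ultimately show ?thesis
    using \<open>strict_mono r\<close> by (intro exI[of _ r] exI[of _ Y] exI[of _ "\<lambda>_ _. 0"]) simp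
qed

end
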